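(* Let $S\in\mathcal A(f)$. Then the following hold: (a) $\operatorname{rank}_{\mathcal A(f)}(S)\le\operatorname{e}(S)$. (b) $\operatorname{rank}_{\mathcal A(f)}(S)=0$ if and only if $S=\Delta(f)$. (c) If $S\neq\Delta(f)$, then $\operatorname{m}(S)\in\operatorname{msg}_{\mathcal A(f)}(S)$. (d) $\operatorname{rank}_{\mathcal A(f)}(S)=1$ if and only if $\operatorname{msg}_{\mathcal A(f)}(S)=\{\operatorname{m}(S)\}$.
   Context: Notation: $\mathbb N=\{0,1,2,\dots\}$, $p\ge 1$, and $\Lambda=\{e_1,\dots,e_p\}$ is the canonical basis of $\mathbb N^p$. $\mathcal C\subseteq\mathbb N^p$ is a fixed non-negative integer cone (the set of points of $\mathbb N^p$ lying in a finitely generated rational convex cone), with at least $p$ extremal rays. A $\mathcal C$-semigroup is a finitely generated submonoid $S\subseteq\mathcal C$ of $\mathbb N^p$ such that the minimal integer cone containing $S$ is $\mathcal C$ and $\mathcal H(S)=\mathcal C\setminus S$ is finite; $\operatorname{msg}(S)$ is its unique minimal generating set as a monoid and $\operatorname{e}(S)$ is the cardinality of $\operatorname{msg}(S)$. A monomial order $\preceq$ on $\mathbb N^p$ is fixed: a total order compatible with addition with $0\preceq x$ for all $x$; it is assumed that $\{x\in\mathcal C\mid x\preceq k\}$ is finite for every $k\in\mathcal C$. $\operatorname{Fb}(S)=\max_\preceq\mathcal H(S)$ (and $-\sum_i e_i$ if $\mathcal H(S)=\emptyset$), $\operatorname{N}(S)=\{x\in S\mid x\prec\operatorname{Fb}(S)\}$,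 $\operatorname{m}(S)=\min_\preceq(S\setminus\{0\})$. A $\mathcal C$-semigroup $S$ is an $\mathcal A$-semigroup if for every $s\in S$ and $e\in\Lambda$ the set $\{s,s+e\}$ is not contained in $\operatorname{N}(S)$. An element $f\in\mathcal C\setminus\{0\}$ is fixed; $\mathcal A(f)$ is the set of all $\mathcal A$-semigroups $S$ with $\operatorname{Fb}(S)=f$, and $\Delta(f)=\{0\}\cup\{x\in\mathcal C\mid x\succ f\}$. A set $X$ is an $\mathcal A(f)$-set if $X\cap\Delta(f)=\emptyset$ and there is $S\in\mathcal A(f)$ with $X\subset S$. For an $\mathcal A(f)$-set $X$, $\mathcal A(f)[X]$ is the intersection of all elements of $\mathcal A(f)$ containing $X$. $X$ is an $\mathcal A(f)$-system of generators of $S$ if $X$ is an $\mathcal A(f)$-set and $S=\mathcal A(f)[X]$; it is minimal if no proper subset $Y\subsetneq X$ satisfies $\mathcal A(f)[Y]=S$. Every $S\in\mathcal A(f)$ has a unique minimal $\mathcal A(f)$-system of generators, namely $\operatorname{msg}_{\mathcal A(f)}(S)=\operatorname{N}(S)\cap\operatorname{msg}(S)$; its cardinality is $\operatorname{rank}_{\mathcal A(f)}(S)$. *)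

theory Defs
  imports "HOL-Analysis.Analysis"
begin

text \<open>
  The monoid of p-tuples of natural numbers is rendered as \<open>nat ^ 'n\<close> with \<open>p = CARD('n)\<close>, so that
  \<open>p \<ge> 1\<close> holds automatically.  Its canonical basis is \<^const>\<open>cart_basis\<close>.
\<close>

definition real_vec :: "nat ^ 'n \<Rightarrow> real ^ 'n" where
  "real_vec x = (\<chi> i. real (x $ i))"

definition int_vec :: "nat ^ 'n \<Rightarrow> int ^ 'n" where
  "int_vec x = (\<chi> i. int (x $ i))"


section \<open>Integer cones\<close>

text \<open>
  The rational generators may have negative entries: cutting a finitely generated rational cone
  down to the nonnegative orthant yields a finitely generated rational cone again.
\<close>

definition integer_cone :: "(nat ^ 'n) set \<Rightarrow> bool" where
  "integer_cone C \<longleftrightarrow>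
     (\<exists>B :: (real ^ 'n) set. finite B \<and> (\<forall>b\<in>B. \<forall>i. b $ i \<in> \<rat>) \<and>
        C = {x. real_vec x \<in> convex_cone hull B})"

text \<open>
  The real cone spanned by an integer cone lies in the nonnegative orthant, hence contains no line,
  so its one-dimensional faces are rays.
\<close>

definition extremal_rays :: "(nat ^ 'n) set \<Rightarrow> (real ^ 'n) set set" where
  "extremal_rays C = {R. R face_of (convex_cone hull (real_vec ` C)) \<and> aff_dim R = 1}"

definition minimal_integer_cone :: "(nat ^ 'n) set \<Rightarrow> (nat ^ 'n) set \<Rightarrow> bool" where
  "minimal_integer_cone S C \<longleftrightarrow>
     integer_cone C \<and> S \<subseteq> C \<and> (\<forall>D. integer_cone D \<and> S \<subseteq> D \<longrightarrow> C \<subseteq> D)"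


section \<open>Submonoids and minimal generating sets\<close>

definition submonoid :: "'a::monoid_add set \<Rightarrow> bool" where
  "submonoid S \<longleftrightarrow> 0 \<in> S \<and> (\<forall>x\<in>S. \<forall>y\<in>S. x + y \<in> S)"

definition finitely_generated :: "'a::monoid_add set \<Rightarrow> bool" where
  "finitely_generated S \<longleftrightarrow> (\<exists>A. finite A \<and> S = submonoid hull A)"

definition minimal_generating_set :: "'a::monoid_add set \<Rightarrow> 'a set \<Rightarrow> bool" where
  "minimal_generating_set S A \<longleftrightarrow> submonoid hull A = S \<and> (\<forall>B. B \<subset> A \<longrightarrow> submonoid hull B \<noteq> S)"

definition msg :: "'a::monoid_add set \<Rightarrow> 'a set" where
  "msg S = (THE A. minimal_generating_set S A)"

definition embedding_dim :: "'a::monoid_add set \<Rightarrow> nat" where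
  "embedding_dim S = card (msg S)"

definition gaps :: "'a set \<Rightarrow> 'a set \<Rightarrow> 'a set" where
  "gaps C S = C - S"

definition C_semigroup :: "(nat ^ 'n) set \<Rightarrow> (nat ^ 'n) set \<Rightarrow> bool" where
  "C_semigroup C S \<longleftrightarrow>
     submonoid S \<and> finitely_generated S \<and> S \<subseteq> C \<and> minimal_integer_cone S C \<and> finite (gaps C S)"


section \<open>Monomial orders\<close>

definition monomial_order :: "(nat ^ 'n \<Rightarrow> nat ^ 'n \<Rightarrow> bool) \<Rightarrow> bool" where
  "monomial_order le \<longleftrightarrow>
     reflp le \<and> antisymp le \<and> transp le \<and> totalp le \<and>
     (\<forall>x y z. le x y \<longrightarrow> le (x + z) (y + z)) \<and> (\<forall>x. le 0 x)"

definition strict :: "('a \<Rightarrow> 'a \<Rightarrow> bool) \<Rightarrow> 'a \<Rightarrow> 'a \<Rightarrow> bool" where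
  "strict le x y \<longleftrightarrow> le x y \<and> x \<noteq> y"

definition max_wrt :: "('a \<Rightarrow> 'a \<Rightarrow> bool) \<Rightarrow> 'a set \<Rightarrow> 'a" where
  "max_wrt le A = (THE m. m \<in> A \<and> (\<forall>x\<in>A. le x m))"

definition min_wrt :: "('a \<Rightarrow> 'a \<Rightarrow> bool) \<Rightarrow> 'a set \<Rightarrow> 'a" where
  "min_wrt le A = (THE m. m \<in> A \<and> (\<forall>x\<in>A. le m x))"


section \<open>Invariants of a semigroup\<close>

text \<open>The Frobenius element is integer-valued, since it has entries \<open>-1\<close> when there are no gaps.\<close>

definition Fb :: "(nat ^ 'n) set \<Rightarrow> (nat ^ 'n \<Rightarrow> nat ^ 'n \<Rightarrow> bool) \<Rightarrow> (nat ^ 'n) set \<Rightarrow> int ^ 'n" where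
  "Fb C le S =
     (if gaps C S = {} then - (\<Sum>e\<in>cart_basis. e) else int_vec (max_wrt le (gaps C S)))"

text \<open>
  If there are no gaps, \<open>Fb C le S\<close> is not the image of a tuple of natural numbers and the set below
  is empty; this is the intended value, because the all-minus-one vector precedes \<open>0\<close> in the
  (unique) extension of the monomial order to integer vectors.
\<close>

definition N_set :: "(nat ^ 'n) set \<Rightarrow> (nat ^ 'n \<Rightarrow> nat ^ 'n \<Rightarrow> bool) \<Rightarrow>
    (nat ^ 'n) set \<Rightarrow> (nat ^ 'n) set" where
  "N_set C le S = {x \<in> S. \<exists>y. int_vec y = Fb C le S \<and> strict le x y}"

definition multiplicity_elem :: "('a::zero \<Rightarrow> 'a \<Rightarrow> bool) \<Rightarrow> 'a set \<Rightarrow> 'a" where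
  "multiplicity_elem le S = min_wrt le (S - {0})"


section \<open>A-semigroups with fixed Frobenius element\<close>

definition A_semigroup :: "(nat ^ 'n) set \<Rightarrow> (nat ^ 'n \<Rightarrow> nat ^ 'n \<Rightarrow> bool) \<Rightarrow>
    (nat ^ 'n) set \<Rightarrow> bool" where
  "A_semigroup C le S \<longleftrightarrow>
     C_semigroup C S \<and> (\<forall>s\<in>S. \<forall>e\<in>cart_basis. \<not> {s, s + e} \<subseteq> N_set C le S)"

definition A_family :: "(nat ^ 'n) set \<Rightarrow> (nat ^ 'n \<Rightarrow> nat ^ 'n \<Rightarrow> bool) \<Rightarrow> nat ^ 'n \<Rightarrow>
    (nat ^ 'n) set set" where
  "A_family C le f = {S. A_semigroup C le S \<and> Fb C le S = int_vec f}"

definition Delta :: "'a::zero set \<Rightarrow> ('a \<Rightarrow> 'a \<Rightarrow> bool) \<Rightarrow> 'a \<Rightarrow> 'a set" where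
  "Delta C le f = {0} \<union> {x \<in> C. strict le f x}"

definition A_set :: "(nat ^ 'n) set \<Rightarrow> (nat ^ 'n \<Rightarrow> nat ^ 'n \<Rightarrow> bool) \<Rightarrow> nat ^ 'n \<Rightarrow>
    (nat ^ 'n) set \<Rightarrow> bool" where
  "A_set C le f X \<longleftrightarrow> X \<inter> Delta C le f = {} \<and> (\<exists>S\<in>A_family C le f. X \<subseteq> S)"

definition A_closure :: "(nat ^ 'n) set \<Rightarrow> (nat ^ 'n \<Rightarrow> nat ^ 'n \<Rightarrow> bool) \<Rightarrow> nat ^ 'n \<Rightarrow>
    (nat ^ 'n) set \<Rightarrow> (nat ^ 'n) set" where
  "A_closure C le f X = \<Inter> {S \<in> A_family C le f. X \<subseteq> S}"

definition A_system_of_generators :: "(nat ^ 'n) set \<Rightarrow> (nat ^ 'n \<Rightarrow> nat ^ 'n \<Rightarrow> bool) \<Rightarrow>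
    nat ^ 'n \<Rightarrow> (nat ^ 'n) set \<Rightarrow> (nat ^ 'n) set \<Rightarrow> bool" where
  "A_system_of_generators C le f S X \<longleftrightarrow> A_set C le f X \<and> S = A_closure C le f X"

definition minimal_A_system :: "(nat ^ 'n) set \<Rightarrow> (nat ^ 'n \<Rightarrow> nat ^ 'n \<Rightarrow> bool) \<Rightarrow>
    nat ^ 'n \<Rightarrow> (nat ^ 'n) set \<Rightarrow> (nat ^ 'n) set \<Rightarrow> bool" where
  "minimal_A_system C le f S X \<longleftrightarrow>
     A_system_of_generators C le f S X \<and> (\<forall>Y. Y \<subset> X \<longrightarrow> A_closure C le f Y \<noteq> S)"

definition msg_A :: "(nat ^ 'n) set \<Rightarrow> (nat ^ 'n \<Rightarrow> nat ^ 'n \<Rightarrow> bool) \<Rightarrow> nat ^ 'n \<Rightarrow>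
    (nat ^ 'n) set \<Rightarrow> (nat ^ 'n) set" where
  "msg_A C le f S = (THE X. minimal_A_system C le f S X)"

definition rank_A :: "(nat ^ 'n) set \<Rightarrow> (nat ^ 'n \<Rightarrow> nat ^ 'n \<Rightarrow> bool) \<Rightarrow> nat ^ 'n \<Rightarrow>
    (nat ^ 'n) set \<Rightarrow> nat" where
  "rank_A C le f S = card (msg_A C le f S)"

end

theory Submission
  imports Defs
begin

text \<open>
  Everything rests on a description of \<^term>\<open>msg_A C le f S\<close> as the set of those atoms (nonzero
  elements that are not a sum of two nonzero elements) of \<open>S\<close> that precede \<open>f\<close>.

  Since the size \<open>\<Sum>i. x $ i\<close> is additive and vanishes only at \<open>0\<close>, every submonoid of
  \<open>nat ^ 'n\<close> is generated by its atoms, and no generating set can omit one; hence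
  \<^term>\<open>msg S\<close> is the set of atoms.  The same dichotomy holds inside the family \<open>A(f)\<close>:

  \<^item> Let \<open>T\<close> be a member of \<open>A(f)\<close> that contains the atoms of \<open>S\<close> preceding \<open>f\<close>.  Then \<open>T\<close>
    contains \<open>S\<close>, because all points of \<open>C\<close> beyond \<open>f\<close> lie in \<open>T\<close> anyway, while an element
    of \<open>S\<close> preceding \<open>f\<close> is a sum of atoms which precede \<open>f\<close> as well.  These atoms therefore
    generate \<open>S\<close> in \<open>A(f)\<close> (lemma \<open>A_closure_atoms_below\<close>).

  \<^item> If \<open>x\<close> is such an atom, then \<^term>\<open>S - {x}\<close> is again a member of \<open>A(f)\<close>
    (lemma \<open>A_family_remove_atom\<close>), so that a generating system without \<open>x\<close> would be contained in
    it and could not generate \<open>S\<close>.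

  The four claims are now statements about atoms.  There are at most as many atoms preceding \<open>f\<close> as
  there are atoms.  If \<open>S\<close> is not \<open>\<Delta>(f)\<close>, it has a nonzero element preceding \<open>f\<close>, so its least
  nonzero element precedes \<open>f\<close>; that element is an atom because a proper summand would be smaller.
\<close>


section \<open>Atoms of submonoids\<close>

definition atoms :: "'a::monoid_add set \<Rightarrow> 'a set" where
  "atoms S = {x \<in> S. x \<noteq> 0 \<and> (\<forall>y\<in>S. \<forall>z\<in>S. x = y + z \<longrightarrow> y = 0 \<or> z = 0)}"

lemma submonoid_hull: "submonoid (submonoid hull A)"
  by (rule hull_in) (auto simp: submonoid_def)

lemma vec_size_eq_0_iff: "(\<Sum>i\<in>UNIV. x $ i) = 0 \<longleftrightarrow> x = 0" for x :: "nat ^ 'n"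
  by (simp add: vec_eq_iff)

lemma vec_add_eq_0_iff: "x + y = 0 \<longleftrightarrow> x = 0 \<and> y = 0" for x y :: "nat ^ 'n"
  by (auto simp: vec_eq_iff)

text \<open>
  Splitting a non-atom into two nonzero summands decreases the size.  Only those atoms that are
  summands of \<open>s\<close> arise in this way, which allows \<open>T\<close> to contain just some of the atoms of \<open>S\<close>.
\<close>

lemma mem_submonoid_if_atom_summands:
  fixes S T :: "(nat ^ 'n) set"
  assumes "submonoid T" and "s \<in> S"
    and "\<And>x y. x \<in> atoms S \<Longrightarrow> s = x + y \<Longrightarrow> x \<in> T"
  shows "s \<in> T"
  using assms(2,3)
proof (induction "\<Sum>i\<in>UNIV. s $ i" arbitrary: s rule: less_induct)
  case less
  consider "s = 0" | "s \<in> atoms S"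
    | y z where "y \<in> S" "z \<in> S" "s = y + z" "y \<noteq> 0" "z \<noteq> 0"
    using less.prems(1) unfolding atoms_def by blast
  then show ?case
  proof cases
    case 1
    then show ?thesis using \<open>submonoid T\<close> by (simp add: submonoid_def)
  next
    case 2
    then show ?thesis using less.prems(2)[of s 0] by simp
  next
    case 3
    have pos: "(\<Sum>i\<in>UNIV. y $ i) > 0" "(\<Sum>i\<in>UNIV. z $ i) > 0"
      using 3(4,5) vec_size_eq_0_iff by (metis gr0I)+
    have "y \<in> T"
    proof (rule less.hyps)
      show "(\<Sum>i\<in>UNIV. y $ i) < (\<Sum>i\<in>UNIV. s $ i)"
        using 3 pos by (simp add: sum.distrib)
      show "x \<in> T" if "x \<in> atoms S" "y = x + w" for x w
        using less.prems(2)[of x "w + z"] that 3 by (simp add: add.assoc)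
    qed (use 3 in auto)
    moreover have "z \<in> T"
    proof (rule less.hyps)
      show "(\<Sum>i\<in>UNIV. z $ i) < (\<Sum>i\<in>UNIV. s $ i)"
        using 3 pos by (simp add: sum.distrib)
      show "x \<in> T" if "x \<in> atoms S" "z = x + w" for x w
        using less.prems(2)[of x "w + y"] that 3 by (simp add: ac_simps)
    qed (use 3 in auto)
    ultimately show ?thesis
      using 3 \<open>submonoid T\<close> by (simp add: submonoid_def)
  qed
qed

lemma submonoid_hull_atoms:
  fixes S :: "(nat ^ 'n) set"
  assumes "submonoid S"
  shows "submonoid hull (atoms S) = S"
proof
  show "submonoid hull (atoms S) \<subseteq> S"
    by (rule hull_minimal) (use assms in \<open>auto simp: atoms_def\<close>)
  show "S \<subseteq> submonoid hull (atoms S)"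
  proof
    fix s assume "s \<in> S"
    then show "s \<in> submonoid hull (atoms S)"
      by (rule mem_submonoid_if_atom_summands[OF submonoid_hull]) (rule hull_inc)
  qed
qed

lemma submonoid_remove_atom:
  assumes "submonoid S" and "x \<in> atoms S"
  shows "submonoid (S - {x})"
  unfolding submonoid_def
proof (intro conjI ballI)
  show "0 \<in> S - {x}" using assms by (simp add: submonoid_def atoms_def)
  fix y z assume yz: "y \<in> S - {x}" "z \<in> S - {x}"
  then have "y + z \<in> S" using assms(1) by (simp add: submonoid_def)
  moreover have "x = y + z \<Longrightarrow> y = 0 \<or> z = 0"
    using assms(2) yz by (simp add: atoms_def)
  ultimately show "y + z \<in> S - {x}" using yz by auto
qed

text \<open>
  An atom cannot be reached by adding other elements: removing from the hull of \<open>A\<close> an atom outside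
  \<open>A\<close> would leave a smaller submonoid that still contains \<open>A\<close>.
\<close>

lemma atoms_hull_subset: "atoms (submonoid hull A) \<subseteq> A"
proof
  fix x assume x: "x \<in> atoms (submonoid hull A)"
  show "x \<in> A"
  proof (rule ccontr)
    assume "x \<notin> A"
    then have "submonoid hull A \<subseteq> (submonoid hull A) - {x}"
      using submonoid_remove_atom[OF submonoid_hull x] hull_subset[of A submonoid]
      by (intro hull_minimal) auto
    then show False using x by (auto simp: atoms_def)
  qed
qed

lemma msg_eq_atoms:
  fixes S :: "(nat ^ 'n) set"
  assumes "submonoid S"
  shows "msg S = atoms S"
  unfolding msg_def
proof (rule the_equality)
  show "minimal_generating_set S (atoms S)"
    unfolding minimal_generating_set_def
    using submonoid_hull_atoms[OF assms] atoms_hull_subset by blast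
  show "A = atoms S" if "minimal_generating_set S A" for A
    using that submonoid_hull_atoms[OF assms] atoms_hull_subset[of A]
    unfolding minimal_generating_set_def by blast
qed

lemma finite_atoms: "finitely_generated S \<Longrightarrow> finite (atoms S)"
  unfolding finitely_generated_def using atoms_hull_subset finite_subset by blast

text \<open>
  An atom \<open>u\<close> of \<^term>\<open>S - {x}\<close> that is not an atom of \<open>S\<close> only splits with a summand \<open>x\<close>, say
  \<open>u = x + z\<close>.  If \<open>z\<close> splits further as \<open>v + w\<close>, then \<open>u = (x + v) + w = (x + w) + v\<close>
  forces \<open>v = w = x\<close>.  So finitely many new atoms arise.
\<close>

lemma atoms_remove_atom_subset:
  fixes S :: "(nat ^ 'n) set"
  assumes "submonoid S" and x: "x \<in> atoms S"
  shows "atoms (S - {x}) \<subseteq> atoms S \<union> (\<lambda>a. x + a) ` atoms S \<union> {x + x + x}"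
proof
  fix u assume u: "u \<in> atoms (S - {x})"
  have x0: "x \<in> S" "x \<noteq> 0" using x by (auto simp: atoms_def)
  have split: "y = x \<or> z = x" if "u = y + z" "y \<in> S" "z \<in> S" "y \<noteq> 0" "z \<noteq> 0" for y z
    using u that unfolding atoms_def by blast
  show "u \<in> atoms S \<union> (\<lambda>a. x + a) ` atoms S \<union> {x + x + x}"
  proof (cases "u \<in> atoms S")
    case False
    then obtain y z where "u = y + z" "y \<in> S" "z \<in> S" "y \<noteq> 0" "z \<noteq> 0"
      using u unfolding atoms_def by blast
    then obtain z where z: "u = x + z" "z \<in> S" "z \<noteq> 0"
      using split[of y z] by (metis add.commute)
    show ?thesis
    proof (cases "z \<in> atoms S")
      case False
      then obtain v w where vw: "z = v + w" "v \<in> S" "w \<in> S" "v \<noteq> 0" "w \<noteq> 0"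
        using z unfolding atoms_def by blast
      have in_S: "x + v \<in> S" "x + w \<in> S" and nz: "x + v \<noteq> 0" "x + w \<noteq> 0"
        using vw x0 \<open>submonoid S\<close> by (auto simp: submonoid_def vec_add_eq_0_iff)
      have ne: "x + v \<noteq> x" "x + w \<noteq> x" using vw by auto
      have "w = x" using split[of "x + v" w] z vw in_S nz ne by (auto simp: ac_simps)
      moreover have "v = x" using split[of "x + w" v] z vw in_S nz ne by (auto simp: ac_simps)
      ultimately show ?thesis using z vw by (simp add: add.assoc)
    qed (use z in auto)
  qed auto
qed

lemma finitely_generated_remove_atom:
  fixes S :: "(nat ^ 'n) set"
  assumes "submonoid S" and "finitely_generated S" and "x \<in> atoms S"
  shows "finitely_generated (S - {x})"
proof -
  have "finite (atoms (S - {x}))"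
    using finite_subset[OF atoms_remove_atom_subset[OF assms(1,3)]] finite_atoms[OF assms(2)]
    by simp
  then show ?thesis
    unfolding finitely_generated_def
    using submonoid_hull_atoms[OF submonoid_remove_atom[OF assms(1,3)]] by metis
qed


section \<open>Removing an atom from a cone semigroup\<close>

lemma integer_cone_halve:
  fixes x :: "nat ^ 'n"
  assumes "integer_cone D" and "x + x \<in> D"
  shows "x \<in> D"
proof -
  obtain B where D: "D = {x. real_vec x \<in> convex_cone hull B}"
    using assms(1) unfolding integer_cone_def by blast
  have "(1/2) *\<^sub>R real_vec (x + x) \<in> convex_cone hull B"
    using assms(2) D by (intro convex_cone_hull_mul) auto
  moreover have "(1/2) *\<^sub>R real_vec (x + x) = real_vec x"
    by (simp add: real_vec_def vec_eq_iff)
  ultimately show ?thesis using D by simp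
qed

text \<open>
  The cone does not shrink, since \<open>x + x\<close> stays in the semigroup and spans the same ray as \<open>x\<close>.
\<close>

lemma C_semigroup_remove_atom:
  fixes S :: "(nat ^ 'n) set"
  assumes S: "C_semigroup C S" and x: "x \<in> atoms S"
  shows "C_semigroup C (S - {x})"
proof -
  have sub: "submonoid S" "finitely_generated S" "S \<subseteq> C" "minimal_integer_cone S C"
    "finite (gaps C S)"
    using S by (auto simp: C_semigroup_def)
  have "x + x \<in> S - {x}"
    using x sub(1) by (auto simp: atoms_def submonoid_def)
  then have "x \<in> D" if "integer_cone D" "S - {x} \<subseteq> D" for D
    using that integer_cone_halve by blast
  then have "minimal_integer_cone (S - {x}) C"
    using sub(4) unfolding minimal_integer_cone_def by blast
  moreover have "finite (gaps C (S - {x}))"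
    by (rule finite_subset[of _ "insert x (gaps C S)"]) (use sub(5) in \<open>auto simp: gaps_def\<close>)
  ultimately show ?thesis
    using sub submonoid_remove_atom[OF sub(1) x] finitely_generated_remove_atom[OF sub(1,2) x]
    unfolding C_semigroup_def by blast
qed


section \<open>Monomial orders and the Frobenius element\<close>

lemma monomial_order_add:
  assumes "monomial_order le"
  shows "le x (x + y)"
proof -
  have "le (0 + x) (y + x)" using assms unfolding monomial_order_def by blast
  then show ?thesis by (simp add: add.commute)
qed

lemma monomial_order_antisym: "monomial_order le \<Longrightarrow> le x y \<Longrightarrow> le y x \<Longrightarrow> x = y"
  unfolding monomial_order_def by (meson antisympD)

lemma monomial_order_trans: "monomial_order le \<Longrightarrow> le x y \<Longrightarrow> le y z \<Longrightarrow> le x z"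
  unfolding monomial_order_def by (meson transpD)

lemma monomial_order_linear: "monomial_order le \<Longrightarrow> le x y \<or> le y x"
  unfolding monomial_order_def by (metis reflpD totalpD)

lemma monomial_order_le_strict_trans:
  "monomial_order le \<Longrightarrow> le x y \<Longrightarrow> strict le y z \<Longrightarrow> strict le x z"
  unfolding strict_def using monomial_order_trans monomial_order_antisym by metis

lemma monomial_order_finite_max:
  assumes "monomial_order le" and "finite A" and "A \<noteq> {}"
  shows "\<exists>m\<in>A. \<forall>x\<in>A. le x m"
  using assms(2,3)
proof (induction rule: finite_ne_induct)
  case (singleton x)
  then show ?case using monomial_order_linear[OF assms(1)] by blast
next
  case (insert a A)
  then show ?case
    using monomial_order_linear[OF assms(1)] monomial_order_trans[OF assms(1)]
    by (metis insert_iff)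
qed

lemma monomial_order_finite_min:
  assumes "monomial_order le" and "finite A" and "A \<noteq> {}"
  shows "\<exists>m\<in>A. \<forall>x\<in>A. le m x"
  using assms(2,3)
proof (induction rule: finite_ne_induct)
  case (singleton x)
  then show ?case using monomial_order_linear[OF assms(1)] by blast
next
  case (insert a A)
  then show ?case
    using monomial_order_linear[OF assms(1)] monomial_order_trans[OF assms(1)]
    by (metis insert_iff)
qed

lemma max_wrt_eq:
  assumes "monomial_order le" and "m \<in> A" and "\<And>x. x \<in> A \<Longrightarrow> le x m"
  shows "max_wrt le A = m"
  unfolding max_wrt_def
  by (rule the_equality) (use assms monomial_order_antisym in blast)+

lemma min_wrt_eq:
  assumes "monomial_order le" and "m \<in> A" and "\<And>x. x \<in> A \<Longrightarrow> le m x"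
  shows "min_wrt le A = m"
  unfolding min_wrt_def
  by (rule the_equality) (use assms monomial_order_antisym in blast)+

lemma int_vec_inject: "int_vec x = int_vec y \<longleftrightarrow> x = y"
  by (simp add: int_vec_def vec_eq_iff)

lemma sum_cart_basis: "(\<Sum>e\<in>cart_basis. e :: 'a::semiring_1 ^ 'n) = (\<chi> i. 1)"
proof -
  have "(\<Sum>e\<in>cart_basis. e) = (\<Sum>i\<in>UNIV. axis i (1 :: 'a) :: 'a ^ 'n)"
    unfolding cart_basis_def Setcompr_eq_image
    by (subst sum.reindex) (auto simp: inj_on_def axis_eq_axis)
  also have "\<dots> = (\<chi> i. 1)"
    by (simp add: vec_eq_iff axis_def)
  finally show ?thesis .
qed

text \<open>
  The value of \<^const>\<open>Fb\<close> in the absence of gaps is no obstacle: it has a negative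
  entry and is thus different from every \<^term>\<open>int_vec f\<close>.
\<close>

lemma Fb_eq_int_vec_iff:
  fixes C S :: "(nat ^ 'n) set"
  assumes ord: "monomial_order le" and fin: "finite (gaps C S)"
  shows "Fb C le S = int_vec f \<longleftrightarrow> f \<in> gaps C S \<and> (\<forall>x\<in>gaps C S. le x f)"
proof (cases "gaps C S = {}")
  case True
  have "(- (\<Sum>e\<in>cart_basis. e) :: int ^ 'n) \<noteq> int_vec f"
    by (simp add: sum_cart_basis int_vec_def vec_eq_iff)
  then show ?thesis using True by (simp add: Fb_def)
next
  case False
  then obtain m where "m \<in> gaps C S" "\<forall>x\<in>gaps C S. le x m"
    using monomial_order_finite_max[OF ord fin] by blast
  then show ?thesis
    using False max_wrt_eq[OF ord, of m "gaps C S"] monomial_order_antisym[OF ord]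
    by (auto simp: Fb_def int_vec_inject)
qed

lemma A_familyD:
  fixes C S :: "(nat ^ 'n) set"
  assumes "monomial_order le" and "S \<in> A_family C le f"
  shows "C_semigroup C S" and "submonoid S" and "finitely_generated S" and "S \<subseteq> C"
    and "f \<in> C" and "f \<notin> S" and "\<And>x. x \<in> C \<Longrightarrow> strict le f x \<Longrightarrow> x \<in> S"
proof -
  show S: "C_semigroup C S"
    using assms(2) by (simp add: A_family_def A_semigroup_def)
  then show "submonoid S" "finitely_generated S" "S \<subseteq> C"
    by (auto simp: C_semigroup_def)
  have "finite (gaps C S)" using S by (simp add: C_semigroup_def)
  then have f: "f \<in> gaps C S" "\<forall>x\<in>gaps C S. le x f"
    using assms Fb_eq_int_vec_iff[OF assms(1)] by (auto simp: A_family_def)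
  then show "f \<in> C" "f \<notin> S" by (auto simp: gaps_def)
  show "x \<in> S" if "x \<in> C" "strict le f x" for x
    using f that monomial_order_antisym[OF assms(1)] by (auto simp: gaps_def strict_def)
qed


section \<open>Minimal systems of generators relative to the family\<close>

definition atoms_below :: "('a::monoid_add \<Rightarrow> 'a \<Rightarrow> bool) \<Rightarrow> 'a \<Rightarrow> 'a set \<Rightarrow> 'a set" where
  "atoms_below le f S = {x \<in> atoms S. strict le x f}"

text \<open>
  The only new gap precedes \<open>f\<close>, so \<open>f\<close> remains the largest gap.  The additional
  condition on \<open>A\<close>-semigroups is inherited because it merely forbids certain pairs in
  \<^const>\<open>N_set\<close>.
\<close>

lemma A_family_remove_atom:
  fixes C S :: "(nat ^ 'n) set"
  assumes ord: "monomial_order le" and S: "S \<in> A_family C le f" and x: "x \<in> atoms_below le f S"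
  shows "S - {x} \<in> A_family C le f"
proof -
  have xa: "x \<in> atoms S" "strict le x f" using x by (auto simp: atoms_below_def)
  have CS: "C_semigroup C (S - {x})"
    using C_semigroup_remove_atom[OF A_familyD(1)[OF ord S] xa(1)] .
  have "gaps C (S - {x}) = insert x (gaps C S)"
    using xa(1) A_familyD(4)[OF ord S] by (auto simp: gaps_def atoms_def)
  moreover have "finite (gaps C (S - {x}))" "finite (gaps C S)"
    using CS A_familyD(1)[OF ord S] by (auto simp: C_semigroup_def)
  ultimately have Fb: "Fb C le (S - {x}) = int_vec f"
    using S xa(2) Fb_eq_int_vec_iff[OF ord] by (auto simp: A_family_def strict_def)
  then have "N_set C le (S - {x}) \<subseteq> N_set C le S"
    using S by (auto simp: A_family_def N_set_def)
  then show ?thesis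
    using S CS Fb unfolding A_family_def A_semigroup_def by blast
qed

lemma A_closure_atoms_below:
  fixes C S :: "(nat ^ 'n) set"
  assumes ord: "monomial_order le" and S: "S \<in> A_family C le f"
  shows "A_closure C le f (atoms_below le f S) = S"
proof
  show "A_closure C le f (atoms_below le f S) \<subseteq> S"
    unfolding A_closure_def using S by (auto simp: atoms_below_def atoms_def)
  have "s \<in> T" if T: "T \<in> A_family C le f" "atoms_below le f S \<subseteq> T" and s: "s \<in> S" for T s
  proof (cases "strict le s f")
    case True
    show ?thesis
    proof (rule mem_submonoid_if_atom_summands[OF A_familyD(2)[OF ord T(1)] s])
      fix x y assume "x \<in> atoms S" "s = x + y"
      moreover from this have "strict le x f"
        using True monomial_order_add[OF ord] monomial_order_le_strict_trans[OF ord] by blast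
      ultimately have "x \<in> atoms_below le f S"
        by (simp add: atoms_below_def)
      then show "x \<in> T" using T(2) by blast
    qed
  next
    case False
    then have "strict le f s"
      using A_familyD(6)[OF ord S] s monomial_order_linear[OF ord, of s f]
      by (auto simp: strict_def)
    then show ?thesis
      using A_familyD(7)[OF ord T(1)] A_familyD(4)[OF ord S] s by blast
  qed
  then show "S \<subseteq> A_closure C le f (atoms_below le f S)"
    unfolding A_closure_def by blast
qed

lemma atoms_below_subset_generators:
  fixes C S :: "(nat ^ 'n) set"
  assumes ord: "monomial_order le" and S: "S \<in> A_family C le f"
    and X: "A_closure C le f X = S"
  shows "atoms_below le f S \<subseteq> X"
proof
  fix x assume x: "x \<in> atoms_below le f S"
  show "x \<in> X"
  proof (rule ccontr)
    assume "x \<notin> X"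
    moreover have "X \<subseteq> S" using X unfolding A_closure_def by blast
    ultimately have "A_closure C le f X \<subseteq> S - {x}"
      unfolding A_closure_def using A_family_remove_atom[OF ord S x] by blast
    then show False using X x by (auto simp: atoms_below_def atoms_def)
  qed
qed

lemma msg_A_eq_atoms_below:
  fixes C S :: "(nat ^ 'n) set"
  assumes ord: "monomial_order le" and S: "S \<in> A_family C le f"
  shows "msg_A C le f S = atoms_below le f S"
  unfolding msg_A_def
proof (rule the_equality)
  have "atoms_below le f S \<inter> Delta C le f = {}"
    using monomial_order_antisym[OF ord]
    by (auto simp: atoms_below_def atoms_def Delta_def strict_def)
  moreover have "atoms_below le f S \<subseteq> S"
    by (auto simp: atoms_below_def atoms_def)
  ultimately show "minimal_A_system C le f S (atoms_below le f S)"
    unfolding minimal_A_system_def A_system_of_generators_def A_set_def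
    using S A_closure_atoms_below[OF ord S] atoms_below_subset_generators[OF ord S] by blast
  show "X = atoms_below le f S" if "minimal_A_system C le f S X" for X
    using that A_closure_atoms_below[OF ord S] atoms_below_subset_generators[OF ord S, of X]
    unfolding minimal_A_system_def A_system_of_generators_def by blast
qed

text \<open>
  A nonzero \<open>s\<close> in \<open>S\<close> preceding \<open>f\<close> bounds the search for the least nonzero element to the finite
  set of points of \<open>C\<close> up to \<open>s\<close>.
\<close>

lemma multiplicity_elem_in_atoms_below:
  fixes C S :: "(nat ^ 'n) set"
  assumes ord: "monomial_order le" and fin: "\<forall>k\<in>C. finite {x \<in> C. le x k}"
    and S: "S \<in> A_family C le f" and ne: "S \<noteq> Delta C le f"
  shows "multiplicity_elem le S \<in> atoms_below le f S"
proof -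
  have "Delta C le f \<subseteq> S"
    using A_familyD[OF ord S] by (auto simp: Delta_def submonoid_def)
  then obtain s where s: "s \<in> S" "s \<notin> Delta C le f" using ne by blast
  then have s0: "s \<noteq> 0" and sf: "strict le s f"
    using A_familyD(4,6)[OF ord S] monomial_order_linear[OF ord, of s f]
    by (auto simp: Delta_def strict_def)
  define A where "A = {x \<in> S - {0}. le x s}"
  have "finite A"
    by (rule finite_subset[of _ "{x \<in> C. le x s}"])
      (use fin s A_familyD(4)[OF ord S] in \<open>auto simp: A_def\<close>)
  moreover have "s \<in> A" using s s0 monomial_order_linear[OF ord] by (auto simp: A_def)
  ultimately obtain m where m: "m \<in> A" "\<forall>x\<in>A. le m x"
    using monomial_order_finite_min[OF ord] by blast
  have least: "le m x" if "x \<in> S - {0}" for x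
    using m that monomial_order_linear[OF ord, of x s] monomial_order_trans[OF ord]
    by (auto simp: A_def)
  have "multiplicity_elem le S = m"
    unfolding multiplicity_elem_def
    by (rule min_wrt_eq[OF ord]) (use m least in \<open>auto simp: A_def\<close>)
  moreover have "y = 0 \<or> z = 0" if "y \<in> S" "z \<in> S" "m = y + z" for y z
  proof (rule ccontr)
    assume "\<not> (y = 0 \<or> z = 0)"
    then have "le m y" "z \<noteq> 0" using least[of y] that by auto
    then have "m = y"
      using monomial_order_add[OF ord, of y z] monomial_order_antisym[OF ord] that by blast
    then show False using that \<open>z \<noteq> 0\<close> by simp
  qed
  moreover have "strict le m f"
    using m(1) sf monomial_order_le_strict_trans[OF ord, of m s f] by (simp add: A_def)
  ultimately show ?thesis
    using m by (simp add: atoms_below_def atoms_def A_def)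
qed

lemma atoms_below_Delta:
  assumes "monomial_order le"
  shows "atoms_below le f (Delta C le f) = {}"
  using monomial_order_antisym[OF assms]
  by (auto simp: atoms_below_def atoms_def Delta_def strict_def)

theorem corollary10:
  fixes C S :: "(nat ^ 'n) set"
    and le :: "nat ^ 'n \<Rightarrow> nat ^ 'n \<Rightarrow> bool"
    and f :: "nat ^ 'n"
  assumes "integer_cone C"
    and "card (extremal_rays C) \<ge> CARD('n)"
    and "monomial_order le"
    and "\<forall>k\<in>C. finite {x \<in> C. le x k}"
    and "f \<in> C - {0}"
    and "S \<in> A_family C le f"
  shows "rank_A C le f S \<le> embedding_dim S
    \<and> (rank_A C le f S = 0 \<longleftrightarrow> S = Delta C le f)
    \<and> (S \<noteq> Delta C le f \<longrightarrow> multiplicity_elem le S \<in> msg_A C le f S)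
    \<and> (rank_A C le f S = 1 \<longleftrightarrow> msg_A C le f S = {multiplicity_elem le S})"
proof -
  note ord = assms(3) and S = assms(6)
  have msg_A: "msg_A C le f S = atoms_below le f S"
    using msg_A_eq_atoms_below[OF ord S] .
  have fin: "finite (atoms S)"
    using finite_atoms A_familyD(3)[OF ord S] by blast
  have sub: "msg_A C le f S \<subseteq> atoms S"
    by (auto simp: msg_A atoms_below_def)
  have fin_A: "finite (msg_A C le f S)"
    using finite_subset[OF sub fin] .
  have a: "rank_A C le f S \<le> embedding_dim S"
    unfolding rank_A_def embedding_dim_def msg_eq_atoms[OF A_familyD(2)[OF ord S]]
    using card_mono[OF fin sub] .
  have c: "multiplicity_elem le S \<in> msg_A C le f S" if "S \<noteq> Delta C le f"
    using multiplicity_elem_in_atoms_below[OF ord assms(4) S that] by (simp add: msg_A)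
  have b: "rank_A C le f S = 0 \<longleftrightarrow> S = Delta C le f"
    using c fin_A atoms_below_Delta[OF ord, of f C] msg_A by (auto simp: rank_A_def)
  have d: "rank_A C le f S = 1 \<longleftrightarrow> msg_A C le f S = {multiplicity_elem le S}"
  proof
    assume one: "rank_A C le f S = 1"
    then have "multiplicity_elem le S \<in> msg_A C le f S" using b c by simp
    then show "msg_A C le f S = {multiplicity_elem le S}"
      using one unfolding rank_A_def by (metis card_1_singletonE singletonD)
  qed (simp add: rank_A_def)
  show ?thesis using a b c d by blast
qed

end
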